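(* Let $d\ge 1$, let $\Theta\subset\mathbb R$ be a convex set, and let $\mathcal J:\mathbb R\times\mathbb R^d\to\mathbb R$, $(\theta,z)\mapsto\mathcal J(\theta,z)$, be a differentiable function satisfying the following two assumptions. (a) $\mathcal J$ is $\mu$-strongly convex: there exists $\mu>0$ such that for all $w_a,w_b\in\mathbb R\times\mathbb R^d$, equivalently, (i) $\mathcal J(w_b)\ge\mathcal J(w_a)+\langle w_b-w_a,\nabla\mathcal J(w_a)\rangle+\frac{\mu}{2}\|w_b-w_a\|^2$, or (ii) $\langle\nabla\mathcal J(w_b)-\nabla\mathcal J(w_a),w_b-w_a\rangle\ge\mu\|w_b-w_a\|^2$. (b) $\mathcal J$ has Lipschitz continuous gradient: there exists $L>0$ such that $\|\nabla\mathcal J(w_b)-\nabla\mathcal J(w_a)\|\le L\|w_b-w_a\|$ for all $w_a,w_b\in\mathbb R\times\mathbb R^d$. Let $(\theta^*,z^* )$ be the unique minimiser of $\mathcal J$ over $\mathbb R\times\mathbb R^d$. Let $(\theta_{j-1},z_j)$ be the $j$-th iterate produced by the alternating minimisation-gradient descent algorithm described in the context, with step size $\alpha$ satisfying $0<\alpha\le 1/L$ and $\alpha\mu\le 1$, and suppose that the approximations $\hat{\mathcal J}^j:\Theta\times\mathbb R^d\to\mathbb R$ and $\widetilde{\mathcal J}^j_z$ used by the algorithm satisfy, for some $\eta>0$, $$\mathbb E_j\Big[\big\|\hat{\mathcal J}^{j}_\theta(\cdot,z_j)-\mathcal J_\theta(\cdot,z_j)\big\|_{L^\infty(\Theta)}^2\Big]+\sum_{k=1}^d\mathbb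 E_j\Big[\big\|\widetilde{\mathcal J}^{j}_{z,k}(\cdot,z_j)-\mathcal J_{z,k}(\cdot,z_j)\big\|_{L^\infty(\Theta)}^2\Big]\le\eta^2\,\|\nabla\mathcal J(\theta_{j-1},z_j)\|^2 .$$ Then $$\mathbb E\big[\|z_{j+1}-z^*\|^2+C_1(\theta_j-\theta^* )^2\big]\le\xi\,\mathbb E\big[\|z_j-z^*\|^2+C_1(\theta_{j-1}-\theta^* )^2\big]$$ for some constants $C_1>0$ and $0<\xi<1$.
   Context: Notation: $w=(\theta,z)$; $\nabla\mathcal J=(\mathcal J_\theta,\mathcal J_z)\in\mathbb R^{1+d}$, where $\mathcal J_\theta$ and $\mathcal J_z=(\mathcal J_{z,1},\dots,\mathcal J_{z,d})$ are the partial derivatives with respect to $\theta$ and $z$; $\|\cdot\|$ and $\langle\cdot,\cdot\rangle$ are the Euclidean norm and inner product. Algorithm: all random variables live on a complete probability space. Start from a given $z_0\in\mathbb R^d$. At iteration $j=0,1,2,\dots$ one constructs (possibly random) approximations: a function $\theta\mapsto\hat{\mathcal J}^j(\theta,z_j)$ on $\Theta$, with $\theta$-derivative $\hat{\mathcal J}^j_\theta(\cdot,z_j)$, approximating $\mathcal J(\cdot,z_j)$; and a function $\theta\mapsto\widetilde{\mathcal J}^j_z(\theta,z_j)=(\widetilde{\mathcal J}^j_{z,1},\dots,\widetilde{\mathcal J}^j_{z,d})(\theta,z_j)\in\mathbb R^d$ on $\Theta$, approximating $\mathcal J_z(\cdot,z_j)$, which need not be the $z$-derivative of $\hat{\mathcal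 J}^j$. For $j\ge1$ these are constructed so that the accuracy condition in the claim holds (for $j=0$ they are computed up to a fixed tolerance). Then one sets $$\theta_j\in\operatorname*{arg\,min}_{\theta\in\Theta}\hat{\mathcal J}^j(\theta,z_j),\qquad z_{j+1}=z_j-\alpha\,\widetilde{\mathcal J}^j_z(\theta_j,z_j).$$ The set $\Theta$ is chosen so that the minimiser $\theta_j$ always lies in its interior, so that $\hat{\mathcal J}^j_\theta(\theta_j,z_j)=0$ for all $j$. $\mathbb E_j[\cdot]$ denotes the expectation conditional on all the random variables used to define $z_j$ (i.e. conditional on the past up to iteration $j$). The condition and conclusion are for iterations $j\ge 1$.
   Formalization: "For some η>0" is taken as "for all sufficiently small η>0" (η ≤ η₀, η₀ depending on the problem data); for arbitrary η the claim fails, e.g. J=(θ²+‖z‖²)/2, exact Ĵ, J̃_z=−z, η=2. The L^∞(Θ) norm is read as the supremum over Θ. *)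

theory Defs
  imports "HOL-Analysis.Analysis" "HOL-Probability.Probability"
begin

definition grad :: "(real \<times> (real ^ 'n) \<Rightarrow> real) \<Rightarrow> real \<times> (real ^ 'n) \<Rightarrow> real \<times> (real ^ 'n)" where
  "grad J w =
     (deriv (\<lambda>t. J (t, snd w)) (fst w),
      \<chi> k. deriv (\<lambda>s. J (fst w, snd w + s *\<^sub>R axis k 1)) 0)"

lemma has_derivative_grad:
  fixes J :: "real \<times> (real ^ 'n) \<Rightarrow> real"
  assumes "J differentiable (at w)"
  shows "(J has_derivative (\<lambda>h. grad J w \<bullet> h)) (at w)"
proof -
  obtain D where D: "(J has_derivative D) (at w)"
    using assms unfolding differentiable_def by blast
  then interpret D: bounded_linear D by (rule has_derivative_bounded_linear)
  have 1: "((\<lambda>t. J (t, snd w)) has_derivative (\<lambda>h. D (h, 0))) (at (fst w))"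
  proof -
    have *: "((\<lambda>t. (t, snd w)) has_derivative (\<lambda>h. (h, 0))) (at (fst w))"
      by (auto intro!: derivative_eq_intros)
    have J: "(J has_derivative D) (at (fst w, snd w))" using D by simp
    show ?thesis using has_derivative_compose[OF * J] .
  qed
  have 1: "fst (grad J w) = D (1, 0)"
  proof -
    have "D (h, 0) = D (1, 0) * h" for h
      using D.scaleR[of h "(1, 0)"] by simp
    then have "(\<lambda>h. D (h, 0)) = (*) (D (1, 0))" by (rule ext)
    with 1 have "((\<lambda>t. J (t, snd w)) has_field_derivative D (1, 0)) (at (fst w))"
      by (simp add: has_field_derivative_def)
    then show ?thesis by (simp add: grad_def DERIV_imp_deriv)
  qed
  have 2: "snd (grad J w) $ k = D (0, axis k 1)" for k
  proof -
    have **: "((\<lambda>s. (fst w, snd w + s *\<^sub>R axis k 1)) has_derivative (\<lambda>h. (0, h *\<^sub>R axis k 1))) (at 0)"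
      by (auto intro!: derivative_eq_intros)
    have J: "(J has_derivative D) (at (fst w, snd w + 0 *\<^sub>R axis k 1))" using D by simp
    have *: "((\<lambda>s. J (fst w, snd w + s *\<^sub>R axis k 1)) has_derivative (\<lambda>h. D (0, h *\<^sub>R axis k 1))) (at 0)"
      using has_derivative_compose[OF ** J] .
    have "D (0, h *\<^sub>R axis k 1) = D (0, axis k 1) * h" for h
      using D.scaleR[of h "(0, axis k 1)"] by simp
    then have "(\<lambda>h. D (0, h *\<^sub>R axis k 1)) = (*) (D (0, axis k 1))" by (rule ext)
    with * have "((\<lambda>s. J (fst w, snd w + s *\<^sub>R axis k 1)) has_field_derivative D (0, axis k 1)) (at 0)"
      by (simp add: has_field_derivative_def)
    then show ?thesis by (simp add: grad_def DERIV_imp_deriv)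
  qed
  have "D h = grad J w \<bullet> h" for h
  proof -
    have "h = fst h *\<^sub>R (1, 0) + (\<Sum>k\<in>UNIV. (snd h $ k) *\<^sub>R (0, axis k 1))"
      using basis_expansion[of "snd h"]
      by (auto simp: prod_eq_iff fst_sum snd_sum scalar_mult_eq_scaleR)
    then have "D h = D (fst h *\<^sub>R (1, 0) + (\<Sum>k\<in>UNIV. (snd h $ k) *\<^sub>R (0, axis k 1)))"
      by simp
    also have "\<dots> = fst h * D (1, 0) + (\<Sum>k\<in>UNIV. snd h $ k * D (0, axis k 1))"
      by (simp only: D.add D.scaleR D.sum real_scaleR_def)
    also have "\<dots> = grad J w \<bullet> h"
      by (simp add: inner_prod_def 1[symmetric] 2[symmetric] inner_vec_def mult.commute)
    finally show ?thesis .
  qed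
  then have "D = (\<lambda>h. grad J w \<bullet> h)" by (rule ext)
  with D show ?thesis by simp
qed

definition strongly_convex :: "real \<Rightarrow> (real \<times> (real ^ 'n) \<Rightarrow> real) \<Rightarrow> bool" where
  "strongly_convex \<mu> J \<longleftrightarrow>
     (\<forall>wa wb. J wb \<ge> J wa + (wb - wa) \<bullet> grad J wa + \<mu> / 2 * (norm (wb - wa))\<^sup>2)"

lemma strongly_convex_iff_monotone_grad:
  fixes J :: "real \<times> (real ^ 'n) \<Rightarrow> real"
  assumes diff: "\<And>w. J differentiable (at w)"
  shows "strongly_convex \<mu> J \<longleftrightarrow>
           (\<forall>wa wb. (grad J wb - grad J wa) \<bullet> (wb - wa) \<ge> \<mu> * (norm (wb - wa))\<^sup>2)"
proof (intro iffI allI)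
  fix wa wb :: "real \<times> (real ^ 'n)"
  assume "strongly_convex \<mu> J"
  then have "J wb \<ge> J wa + (wb - wa) \<bullet> grad J wa + \<mu> / 2 * (norm (wb - wa))\<^sup>2"
    and "J wa \<ge> J wb + (wa - wb) \<bullet> grad J wb + \<mu> / 2 * (norm (wa - wb))\<^sup>2"
    unfolding strongly_convex_def by blast+
  then show "(grad J wb - grad J wa) \<bullet> (wb - wa) \<ge> \<mu> * (norm (wb - wa))\<^sup>2"
    by (simp add: norm_minus_commute[of wa wb] inner_diff_left inner_diff_right inner_commute)
next
  assume mono: "\<forall>wa wb. (grad J wb - grad J wa) \<bullet> (wb - wa) \<ge> \<mu> * (norm (wb - wa))\<^sup>2"
  show "strongly_convex \<mu> J"
    unfolding strongly_convex_def
  proof (intro allI)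
    fix wa wb :: "real \<times> (real ^ 'n)"
    define v where "v = wb - wa"
    define k where "k t = J (wa + t *\<^sub>R v) - t * (grad J wa \<bullet> v) - \<mu> / 2 * t\<^sup>2 * (norm v)\<^sup>2" for t
    have "\<exists>y. DERIV k t :> y \<and> 0 \<le> y" if "0 \<le> t" for t
    proof -
      have "((\<lambda>t. wa + t *\<^sub>R v) has_derivative (\<lambda>h. h *\<^sub>R v)) (at t)"
        by (auto intro!: derivative_eq_intros)
      from has_derivative_compose[OF this has_derivative_grad[OF diff]]
      have "((\<lambda>t. J (wa + t *\<^sub>R v)) has_derivative (*) (grad J (wa + t *\<^sub>R v) \<bullet> v)) (at t)"
        by (simp add: mult.commute[of _ "grad J _ \<bullet> _"])
      then have "((\<lambda>t. J (wa + t *\<^sub>R v)) has_real_derivative grad J (wa + t *\<^sub>R v) \<bullet> v) (at t)"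
        by (simp add: has_field_derivative_def)
      then have "(k has_real_derivative
                   (grad J (wa + t *\<^sub>R v) - grad J wa) \<bullet> v - \<mu> * t * (norm v)\<^sup>2) (at t)"
        unfolding k_def by (auto intro!: derivative_eq_intros simp: inner_diff_left)
      moreover have "0 \<le> (grad J (wa + t *\<^sub>R v) - grad J wa) \<bullet> v - \<mu> * t * (norm v)\<^sup>2"
      proof (cases "t = 0")
        case False
        with that have t: "t > 0" by simp
        have "\<mu> * (norm (t *\<^sub>R v))\<^sup>2 \<le> (grad J (wa + t *\<^sub>R v) - grad J wa) \<bullet> (t *\<^sub>R v)"
          using mono[rule_format, of "wa + t *\<^sub>R v" wa] by simp
        then have "t * (\<mu> * t * (norm v)\<^sup>2) \<le> t * ((grad J (wa + t *\<^sub>R v) - grad J wa) \<bullet> v)"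
          by (simp add: power_mult_distrib power2_eq_square ac_simps)
        with t show ?thesis by simp
      qed simp
      ultimately show ?thesis by blast
    qed
    then have "k 0 \<le> k 1"
      using DERIV_nonneg_imp_nondecreasing[of 0 1 k] zero_le_one by blast
    then show "J wb \<ge> J wa + (wb - wa) \<bullet> grad J wa + \<mu> / 2 * (norm (wb - wa))\<^sup>2"
      by (simp add: k_def v_def inner_commute)
  qed
qed

text \<open>
  The approximations are functions defined pointwise on \<open>\<Theta>\<close> and are evaluated at the single point
  \<open>\<theta> j\<close>, so the norm of \<open>L\<^sup>\<infinity>(\<Theta>)\<close> is the supremum over \<open>\<Theta>\<close>, not an essential supremum.  It is
  \<open>\<infinity>\<close> for unbounded functions.
\<close>

definition sup_norm_on :: "'a set \<Rightarrow> ('a \<Rightarrow> real) \<Rightarrow> ennreal" where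
  "sup_norm_on S f = (SUP x\<in>S. ennreal \<bar>f x\<bar>)"

text \<open>
  In \<open>Jh j \<omega> t x\<close>, \<open>DJh j \<omega> t x\<close> and \<open>Jt j \<omega> t x\<close> (the approximation of \<open>\<J>\<close>, its \<open>\<theta>\<close>-derivative,
  and the approximation of the \<open>z\<close>-gradient), \<open>j\<close> is the iteration, \<open>\<omega>\<close> the outcome, and \<open>(t, x)\<close>
  the argument; only \<open>t \<in> \<Theta>\<close> and \<open>x = z j \<omega>\<close> matter.

  \<open>F j\<close> is the past up to the construction of \<open>z j\<close>: it contains the information of \<open>z j\<close>, of
  \<open>\<theta> i\<close> for \<open>i < j\<close>, and of the approximations built in the iterations \<open>i < j\<close>.
  The derivative is one-sided at an endpoint of \<open>\<Theta>\<close> belonging to \<open>\<Theta>\<close>.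
\<close>

locale alternating_descent = prob_space M + complete_measure M + filtration "space M" F
  for M :: "'p measure" and F :: "nat \<Rightarrow> 'p measure" +
  fixes \<Theta> :: "real set" and \<alpha> :: real and z0 :: "real ^ 'n"
    and Jh DJh :: "nat \<Rightarrow> 'p \<Rightarrow> real \<Rightarrow> real ^ 'n \<Rightarrow> real"
    and Jt :: "nat \<Rightarrow> 'p \<Rightarrow> real \<Rightarrow> real ^ 'n \<Rightarrow> real ^ 'n"
    and \<theta> :: "nat \<Rightarrow> 'p \<Rightarrow> real" and z :: "nat \<Rightarrow> 'p \<Rightarrow> real ^ 'n"
  assumes subalgebra_F: "\<And>j. subalgebra M (F j)"
    and measurable_z: "\<And>j. z j \<in> borel_measurable (F j)"
    and measurable_theta: "\<And>j. \<theta> j \<in> borel_measurable (F (Suc j))"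
    and measurable_Jh: "\<And>j t. t \<in> \<Theta> \<Longrightarrow> (\<lambda>\<omega>. Jh j \<omega> t (z j \<omega>)) \<in> borel_measurable (F (Suc j))"
    and measurable_Jt: "\<And>j t. t \<in> \<Theta> \<Longrightarrow> (\<lambda>\<omega>. Jt j \<omega> t (z j \<omega>)) \<in> borel_measurable (F (Suc j))"
    and z_0: "AE \<omega> in M. z 0 \<omega> = z0"
    and derivative_Jh: "\<And>j. AE \<omega> in M. \<forall>t\<in>\<Theta>.
          ((\<lambda>s. Jh j \<omega> s (z j \<omega>)) has_real_derivative DJh j \<omega> t (z j \<omega>)) (at t within \<Theta>)"
    and theta_arg_min: "\<And>j. AE \<omega> in M.
          is_arg_min (\<lambda>t. Jh j \<omega> t (z j \<omega>)) (\<lambda>t. t \<in> \<Theta>) (\<theta> j \<omega>)"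
    and theta_interior: "\<And>j. AE \<omega> in M. \<theta> j \<omega> \<in> interior \<Theta>"
    and z_Suc: "\<And>j. AE \<omega> in M. z (Suc j) \<omega> = z j \<omega> - \<alpha> *\<^sub>R Jt j \<omega> (\<theta> j \<omega>) (z j \<omega>)"

text \<open>
  The errors are explicitly required to be random variables, since \<^const>\<open>nn_cond_exp\<close> is \<open>0\<close> on
  non-measurable functions.  No integrability is required.
\<close>

definition accurate ::
  "'p measure \<Rightarrow> (nat \<Rightarrow> 'p measure) \<Rightarrow> real set \<Rightarrow> (real \<times> (real ^ 'n) \<Rightarrow> real)
   \<Rightarrow> (nat \<Rightarrow> 'p \<Rightarrow> real \<Rightarrow> real ^ 'n \<Rightarrow> real) \<Rightarrow> (nat \<Rightarrow> 'p \<Rightarrow> real \<Rightarrow> real ^ 'n \<Rightarrow> real ^ 'n)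
   \<Rightarrow> (nat \<Rightarrow> 'p \<Rightarrow> real) \<Rightarrow> (nat \<Rightarrow> 'p \<Rightarrow> real ^ 'n) \<Rightarrow> real \<Rightarrow> nat \<Rightarrow> bool" where
  "accurate M F \<Theta> J DJh Jt \<theta> z \<eta> j \<longleftrightarrow>
     (let e = (\<lambda>\<omega>. sup_norm_on \<Theta> (\<lambda>t. DJh j \<omega> t (z j \<omega>) - fst (grad J (t, z j \<omega>))));
          e' = (\<lambda>k \<omega>. sup_norm_on \<Theta> (\<lambda>t. Jt j \<omega> t (z j \<omega>) $ k - snd (grad J (t, z j \<omega>)) $ k))
      in e \<in> borel_measurable M \<and> (\<forall>k. e' k \<in> borel_measurable M) \<and>
         (AE \<omega> in M.
            nn_cond_exp M (F j) (\<lambda>\<omega>. (e \<omega>)\<^sup>2) \<omega>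
              + (\<Sum>k\<in>UNIV. nn_cond_exp M (F j) (\<lambda>\<omega>. (e' k \<omega>)\<^sup>2) \<omega>)
            \<le> ennreal (\<eta>\<^sup>2 * (norm (grad J (\<theta> (j - 1) \<omega>, z j \<omega>)))\<^sup>2)))"

end

theory Submission
  imports Defs
begin

text \<open>
  Write \<open>w = (\<theta>\<^sub>j, z\<^sub>j)\<close> and \<open>g = \<nabla>J w\<close>.  Strong convexity together with
  \<open>\<parallel>g\<parallel>\<^sup>2 \<le> 2 L (J w - J w\<^sup>*)\<close> gives
  \<open>\<langle>g, w - w\<^sup>*\<rangle> \<ge> \<parallel>g\<parallel>\<^sup>2 / (2 L) + \<mu> / 2 \<parallel>w - w\<^sup>*\<parallel>\<^sup>2\<close>.  Hence an exact gradient step in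
  \<open>z\<close> alone contracts \<open>\<parallel>z - z\<^sup>*\<parallel>\<^sup>2\<close> by \<open>1 - \<alpha>\<mu>\<close>, up to a multiple of \<open>g\<^sub>\<theta>\<^sup>2\<close>, and leaves over the
  negative term \<open>- (\<alpha>\<mu> / 2) (\<theta>\<^sub>j - \<theta>\<^sup>*)\<^sup>2\<close>, which pays for the \<open>\<theta>\<close>-part on the left-hand side with
  \<open>C\<^sub>1 = \<alpha>\<mu> / 2\<close>.  As \<open>\<theta>\<^sub>j\<close> is a critical point of the approximation, \<open>\<bar>g\<^sub>\<theta>\<bar>\<close> is at most its
  approximation error; so all errors are bounded in mean square by
  \<open>\<eta>\<^sup>2 L\<^sup>2 \<parallel>(\<theta>\<^sub>j\<^sub>-\<^sub>1, z\<^sub>j) - w\<^sup>*\<parallel>\<^sup>2\<close>, and for small \<open>\<eta>\<close> the contraction survives with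
  \<open>\<xi> = 1 - \<alpha>\<mu> / 4\<close>.
\<close>

section \<open>Gradient inequalities from smoothness and strong convexity\<close>

lemma grad_eqI:
  fixes J :: "real \<times> (real ^ 'n) \<Rightarrow> real"
  assumes "(J has_derivative (\<lambda>h. g \<bullet> h)) (at w)"
  shows "grad J w = g"
proof -
  have "J differentiable (at w)"
    using assms unfolding differentiable_def by blast
  from has_derivative_unique[OF has_derivative_grad[OF this] assms]
  have "\<forall>h. grad J w \<bullet> h = g \<bullet> h" by meson
  then show ?thesis by (rule vector_eq_rdot[THEN iffD1])
qed

lemma grad_uminus:
  fixes J :: "real \<times> (real ^ 'n) \<Rightarrow> real"
  assumes "J differentiable (at w)"
  shows "grad (\<lambda>x. - J x) w = - grad J w"
  using has_derivative_minus[OF has_derivative_grad[OF assms]]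
  by (intro grad_eqI) simp

lemma lipschitz_grad_upper_bound:
  fixes J :: "real \<times> (real ^ 'n) \<Rightarrow> real"
  assumes diff: "\<And>w. J differentiable (at w)" and lip: "L-lipschitz_on UNIV (grad J)"
  shows "J wb \<le> J wa + (wb - wa) \<bullet> grad J wa + L / 2 * (norm (wb - wa))\<^sup>2"
proof -
  \<comment> \<open>An upper quadratic bound for \<open>J\<close> is strong convexity of \<open>- J\<close> with the negative modulus \<open>- L\<close>.\<close>
  have "strongly_convex (- L) (\<lambda>x. - J x)"
  proof (subst strongly_convex_iff_monotone_grad)
    show "\<And>w. (\<lambda>x. - J x) differentiable (at w)" using diff by simp
    show "\<forall>wa wb. - L * (norm (wb - wa))\<^sup>2
        \<le> (grad (\<lambda>x. - J x) wb - grad (\<lambda>x. - J x) wa) \<bullet> (wb - wa)"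
    proof (intro allI)
      fix wa wb
      have "(grad J wb - grad J wa) \<bullet> (wb - wa) \<le> norm (grad J wb - grad J wa) * norm (wb - wa)"
        by (rule norm_cauchy_schwarz)
      also have "\<dots> \<le> (L * norm (wb - wa)) * norm (wb - wa)"
        using lipschitz_onD[OF lip, of wb wa] by (intro mult_right_mono) (auto simp: dist_norm)
      finally show "- L * (norm (wb - wa))\<^sup>2
          \<le> (grad (\<lambda>x. - J x) wb - grad (\<lambda>x. - J x) wa) \<bullet> (wb - wa)"
        by (simp add: grad_uminus[OF diff] power2_eq_square mult.assoc inner_diff_left)
    qed
  qed
  then have "- J wb \<ge> - J wa + (wb - wa) \<bullet> grad (\<lambda>x. - J x) wa + - L / 2 * (norm (wb - wa))\<^sup>2"
    unfolding strongly_convex_def by blast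
  then show ?thesis
    by (simp add: grad_uminus[OF diff])
qed

text \<open>The trial point \<open>w - (1 / L) *\<^sub>R grad J w\<close> minimises the quadratic
  upper bound around \<open>w\<close>, and the value of \<open>J\<close> there cannot lie below the
  minimum. Taking \<open>w = ws\<close> forces the gradient to vanish at the minimiser.\<close>

lemma norm_grad_le_gap:
  fixes J :: "real \<times> (real ^ 'n) \<Rightarrow> real"
  assumes diff: "\<And>w. J differentiable (at w)" and lip: "L-lipschitz_on UNIV (grad J)"
    and "L > 0" and min: "is_arg_min J (\<lambda>_. True) ws"
  shows "(norm (grad J w))\<^sup>2 \<le> 2 * L * (J w - J ws)"
proof -
  define g where "g = grad J w"
  have "J ws \<le> J (w - (1 / L) *\<^sub>R g)"
    using min unfolding is_arg_min_def by (meson not_le)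
  also have "\<dots> \<le> J w - (norm g)\<^sup>2 / L + L / 2 * ((norm g)\<^sup>2 / L\<^sup>2)"
    using lipschitz_grad_upper_bound[OF diff lip, of "w - (1 / L) *\<^sub>R g" w] \<open>L > 0\<close>
    by (simp add: g_def[symmetric] dot_square_norm power_divide)
  also have "\<dots> = J w - (norm g)\<^sup>2 / (2 * L)"
    using \<open>L > 0\<close> by (simp add: power2_eq_square field_simps)
  finally show ?thesis
    using \<open>L > 0\<close> by (simp add: g_def field_simps)
qed

lemma grad_arg_min_eq_0:
  fixes J :: "real \<times> (real ^ 'n) \<Rightarrow> real"
  assumes "\<And>w. J differentiable (at w)" "L-lipschitz_on UNIV (grad J)" "L > 0"
    "is_arg_min J (\<lambda>_. True) ws"
  shows "grad J ws = 0"
  using norm_grad_le_gap[OF assms, of ws] by simp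

text \<open>Monotonicity of the gradient alone would give
  \<open>\<mu> * (norm (w - ws))\<^sup>2\<close> and no gradient term. Giving up half of the modulus
  buys \<open>(norm (grad J w))\<^sup>2 / (2 * L)\<close>, which later absorbs the second-order term
  of the step.\<close>

lemma inner_grad_lower_bound:
  fixes J :: "real \<times> (real ^ 'n) \<Rightarrow> real"
  assumes diff: "\<And>w. J differentiable (at w)" and lip: "L-lipschitz_on UNIV (grad J)"
    and "L > 0" and min: "is_arg_min J (\<lambda>_. True) ws" and sc: "strongly_convex \<mu> J"
  shows "(norm (grad J w))\<^sup>2 / (2 * L) + \<mu> / 2 * (norm (w - ws))\<^sup>2 \<le> grad J w \<bullet> (w - ws)"
proof -
  have "J ws \<ge> J w + (ws - w) \<bullet> grad J w + \<mu> / 2 * (norm (ws - w))\<^sup>2"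
    using sc unfolding strongly_convex_def by blast
  moreover have "(norm (grad J w))\<^sup>2 / (2 * L) \<le> J w - J ws"
    using norm_grad_le_gap[OF diff lip \<open>L > 0\<close> min, of w] \<open>L > 0\<close> by (simp add: field_simps)
  ultimately show ?thesis
    by (simp add: norm_minus_commute inner_diff_left inner_diff_right inner_commute)
qed

section \<open>One inexact gradient step in \<open>z\<close>, without probability\<close>

lemma two_mult_le_weighted_squares:
  fixes a b c :: real
  assumes "c > 0"
  shows "2 * (a * b) \<le> c * a\<^sup>2 + b\<^sup>2 / c"
proof -
  have "0 \<le> (c * a - b)\<^sup>2 / c" using assms by simp
  also have "\<dots> = c * a\<^sup>2 + b\<^sup>2 / c - 2 * (a * b)"
    using assms by (simp add: power2_eq_square field_simps)
  finally show ?thesis by simp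
qed

text \<open>A small weight \<open>c\<close> keeps the factor on \<open>x\<close>, the exact step,
  close to 1; the price \<open>1 / c\<close> falls on the error \<open>y\<close>.\<close>

lemma norm_diff_square_le:
  fixes x y :: "'a :: real_inner"
  assumes "c > 0"
  shows "(norm (x - y))\<^sup>2 \<le> (1 + c) * (norm x)\<^sup>2 + (1 + 1 / c) * (norm y)\<^sup>2"
proof -
  have "(norm (x - y))\<^sup>2 = (norm x)\<^sup>2 + (norm y)\<^sup>2 - 2 * (x \<bullet> y)"
    by (simp add: power2_norm_eq_inner inner_diff_left inner_diff_right inner_commute)
  also have "\<dots> \<le> (norm x)\<^sup>2 + (norm y)\<^sup>2 + 2 * (norm x * norm y)"
    using Cauchy_Schwarz_ineq2[of x y] by linarith
  also have "\<dots> \<le> (1 + c) * (norm x)\<^sup>2 + (1 + 1 / c) * (norm y)\<^sup>2"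
    using two_mult_le_weighted_squares[OF assms, of "norm x" "norm y"] by (simp add: algebra_simps)
  finally show ?thesis .
qed

text \<open>The inner product bound concerns the full gradient, while the step moves only
  \<open>z\<close>. The surplus product of the \<theta>-derivative and \<open>t - \<theta>s\<close>
  is split by Young's inequality, which leaves the squared derivative on the right as a further
  error.\<close>

lemma exact_partial_gradient_step:
  fixes J :: "real \<times> (real ^ 'n) \<Rightarrow> real"
  assumes diff: "\<And>w. J differentiable (at w)" and lip: "L-lipschitz_on UNIV (grad J)"
    and "L > 0" and min: "is_arg_min J (\<lambda>_. True) (\<theta>s, zs)"
    and sc: "strongly_convex \<mu> J" and "\<mu> > 0" and "0 < \<alpha>" and "\<alpha> \<le> 1 / L"
  shows "(norm (y - zs - \<alpha> *\<^sub>R snd (grad J (t, y))))\<^sup>2 + \<alpha> * \<mu> / 2 * (t - \<theta>s)\<^sup>2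
    \<le> (1 - \<alpha> * \<mu>) * (norm (y - zs))\<^sup>2 + 2 * \<alpha> / \<mu> * (fst (grad J (t, y)))\<^sup>2"
proof -
  define gt gz where "gt = fst (grad J (t, y))" and "gz = snd (grad J (t, y))"
  define p where "p = gz \<bullet> (y - zs)"
  have g: "grad J (t, y) = (gt, gz)" by (simp add: gt_def gz_def)
  have "(gt\<^sup>2 + (norm gz)\<^sup>2) / (2 * L) + \<mu> / 2 * ((t - \<theta>s)\<^sup>2 + (norm (y - zs))\<^sup>2)
      \<le> gt * (t - \<theta>s) + p"
    using inner_grad_lower_bound[OF diff lip \<open>L > 0\<close> min sc, of "(t, y)"]
    by (simp add: g norm_Pair p_def)
  \<comment> \<open>The factor \<open>2 * \<alpha>\<close> is that of the cross term in the expanded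
    square of the step.\<close>
  then have "(2 * \<alpha>) * ((gt\<^sup>2 + (norm gz)\<^sup>2) / (2 * L) + \<mu> / 2 * ((t - \<theta>s)\<^sup>2 + (norm (y - zs))\<^sup>2))
      \<le> (2 * \<alpha>) * (gt * (t - \<theta>s) + p)"
    using \<open>0 < \<alpha>\<close> by (intro mult_left_mono) auto
  then have 1: "\<alpha> / L * (gt\<^sup>2 + (norm gz)\<^sup>2) + \<alpha> * \<mu> * ((t - \<theta>s)\<^sup>2 + (norm (y - zs))\<^sup>2)
      \<le> 2 * \<alpha> * (gt * (t - \<theta>s)) + 2 * \<alpha> * p"
    by (simp add: algebra_simps add_divide_distrib)
  \<comment> \<open>Here \<open>\<alpha> \<le> 1 / L\<close> enters: the second-order term of the
    step is covered by the gradient term of the inner product bound.\<close>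
  have "\<alpha> * \<alpha> \<le> \<alpha> * (1 / L)"
    using assms by (intro mult_left_mono) auto
  then have "\<alpha>\<^sup>2 * (norm gz)\<^sup>2 \<le> \<alpha> / L * (norm gz)\<^sup>2"
    by (intro mult_right_mono) (auto simp: power2_eq_square)
  also have "\<dots> \<le> \<alpha> / L * (gt\<^sup>2 + (norm gz)\<^sup>2)"
    using assms by (intro mult_left_mono) auto
  finally have 2: "\<alpha>\<^sup>2 * (norm gz)\<^sup>2 \<le> \<alpha> / L * (gt\<^sup>2 + (norm gz)\<^sup>2)" .
  \<comment> \<open>The weight \<open>2 / \<mu>\<close> consumes exactly half of the available
    \<open>\<alpha> * \<mu> * (t - \<theta>s)\<^sup>2\<close>; the other half stays on the left of
    the claim.\<close>
  have "\<alpha> * (2 * (gt * (t - \<theta>s))) \<le> \<alpha> * (2 / \<mu> * gt\<^sup>2 + (t - \<theta>s)\<^sup>2 / (2 / \<mu>))"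
    using two_mult_le_weighted_squares[of "2 / \<mu>" gt "t - \<theta>s"] assms by (intro mult_left_mono) auto
  then have 3: "2 * \<alpha> * (gt * (t - \<theta>s)) \<le> 2 * \<alpha> / \<mu> * gt\<^sup>2 + \<alpha> * \<mu> / 2 * (t - \<theta>s)\<^sup>2"
    by (simp add: algebra_simps)
  \<comment> \<open>The instantiated bilinearity rules keep \<open>y - zs\<close> whole, so that the
    cross term matches \<open>p\<close>.\<close>
  have "(norm (y - zs - \<alpha> *\<^sub>R gz))\<^sup>2
      = (norm (y - zs))\<^sup>2 - 2 * \<alpha> * p + \<alpha>\<^sup>2 * (norm gz)\<^sup>2"
    unfolding power2_norm_eq_inner p_def
    by (simp only: inner_diff_left[of "y - zs"] inner_diff_right[of _ "y - zs"]
        inner_scaleR_left inner_scaleR_right inner_commute[of "y - zs" gz])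
       (simp add: algebra_simps power2_eq_square)
  with 1 2 3 show ?thesis
    unfolding gt_def[symmetric] gz_def[symmetric] by (simp add: algebra_simps)
qed

text \<open>The inexact step is the exact one minus \<alpha> times the gradient error. Separating
  the two with weight \<open>q / 2\<close>, where \<open>q = \<alpha> * \<mu>\<close>, sacrifices
  half of the contraction \<open>1 - q\<close>.\<close>

lemma perturbed_partial_gradient_step:
  fixes J :: "real \<times> (real ^ 'n) \<Rightarrow> real" and v :: "real ^ 'n"
  assumes diff: "\<And>w. J differentiable (at w)" and lip: "L-lipschitz_on UNIV (grad J)"
    and "L > 0" and min: "is_arg_min J (\<lambda>_. True) (\<theta>s, zs)"
    and sc: "strongly_convex \<mu> J" and "\<mu> > 0" and "0 < \<alpha>" and "\<alpha> \<le> 1 / L" and "\<alpha> * \<mu> \<le> 1"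
  shows "(norm (y - \<alpha> *\<^sub>R v - zs))\<^sup>2 + \<alpha> * \<mu> / 2 * (t - \<theta>s)\<^sup>2
    \<le> (1 - \<alpha> * \<mu> / 2) * (norm (y - zs))\<^sup>2 + 3 * \<alpha> / \<mu> * (fst (grad J (t, y)))\<^sup>2
      + (1 + 2 / (\<alpha> * \<mu>)) * \<alpha>\<^sup>2 * (norm (v - snd (grad J (t, y))))\<^sup>2"
proof -
  define gt gz where "gt = fst (grad J (t, y))" and "gz = snd (grad J (t, y))"
  define q where "q = \<alpha> * \<mu>"
  have q: "0 < q" "q \<le> 1" using assms by (auto simp: q_def)
  have "y - \<alpha> *\<^sub>R v - zs = (y - zs - \<alpha> *\<^sub>R gz) - \<alpha> *\<^sub>R (v - gz)"
    by (simp add: algebra_simps)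
  moreover have "(norm ((y - zs - \<alpha> *\<^sub>R gz) - \<alpha> *\<^sub>R (v - gz)))\<^sup>2
      \<le> (1 + q / 2) * (norm (y - zs - \<alpha> *\<^sub>R gz))\<^sup>2 + (1 + 2 / q) * (\<alpha>\<^sup>2 * (norm (v - gz))\<^sup>2)"
    using norm_diff_square_le[of "q / 2" "y - zs - \<alpha> *\<^sub>R gz" "\<alpha> *\<^sub>R (v - gz)"] q
    by (simp add: power_mult_distrib)
  ultimately have "(norm (y - \<alpha> *\<^sub>R v - zs))\<^sup>2
      \<le> (1 + q / 2) * (norm (y - zs - \<alpha> *\<^sub>R gz))\<^sup>2 + (1 + 2 / q) * (\<alpha>\<^sup>2 * (norm (v - gz))\<^sup>2)"
    by (simp only:)
  moreover have "(1 + q / 2) * (norm (y - zs - \<alpha> *\<^sub>R gz))\<^sup>2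
      \<le> (1 + q / 2) * ((1 - q) * (norm (y - zs))\<^sup>2 + 2 * \<alpha> / \<mu> * gt\<^sup>2 - q / 2 * (t - \<theta>s)\<^sup>2)"
    using exact_partial_gradient_step[OF diff lip \<open>L > 0\<close> min sc \<open>\<mu> > 0\<close> \<open>0 < \<alpha>\<close> \<open>\<alpha> \<le> 1 / L\<close>, of y t] q
    unfolding gt_def[symmetric] gz_def[symmetric] q_def[symmetric]
    by (intro mult_left_mono) auto
  \<comment> \<open>The product of the factors is \<open>1 - q / 2 - q\<^sup>2 / 2\<close>.\<close>
  moreover have "(1 + q / 2) * (1 - q) * (norm (y - zs))\<^sup>2 \<le> (1 - q / 2) * (norm (y - zs))\<^sup>2"
    using q by (intro mult_right_mono) (auto simp: algebra_simps)
  \<comment> \<open>From \<open>q \<le> 1\<close> the factor is at most 3/2, which produces the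
    constant \<open>3 * \<alpha> / \<mu>\<close>.\<close>
  moreover have "(1 + q / 2) * (2 * \<alpha> / \<mu> * gt\<^sup>2) \<le> 3 / 2 * (2 * \<alpha> / \<mu> * gt\<^sup>2)"
    using q assms by (intro mult_right_mono) auto
  moreover have "1 * (q / 2 * (t - \<theta>s)\<^sup>2) \<le> (1 + q / 2) * (q / 2 * (t - \<theta>s)\<^sup>2)"
    using q by (intro mult_right_mono) auto
  moreover have "(1 + q / 2) * ((1 - q) * (norm (y - zs))\<^sup>2 + 2 * \<alpha> / \<mu> * gt\<^sup>2 - q / 2 * (t - \<theta>s)\<^sup>2)
      = (1 + q / 2) * (1 - q) * (norm (y - zs))\<^sup>2 + (1 + q / 2) * (2 * \<alpha> / \<mu> * gt\<^sup>2)
        - (1 + q / 2) * (q / 2 * (t - \<theta>s)\<^sup>2)"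
    by (simp only: distrib_left right_diff_distrib[of _ "_ + _"] mult.assoc)
  moreover have "3 / 2 * (2 * \<alpha> / \<mu> * gt\<^sup>2) = 3 * \<alpha> / \<mu> * gt\<^sup>2" by simp
  ultimately show ?thesis
    unfolding gt_def[symmetric] gz_def[symmetric] q_def[symmetric] mult.assoc by linarith
qed

section \<open>Expectations of sup-norm errors\<close>

lemma (in prob_space) nn_integral_nn_cond_exp:
  assumes "subalgebra M G" and "f \<in> borel_measurable M"
  shows "(\<integral>\<^sup>+ x. nn_cond_exp M G f x \<partial>M) = (\<integral>\<^sup>+ x. f x \<partial>M)"
proof -
  interpret finite_measure_subalgebra M G
    using assms(1) by unfold_locales
  show ?thesis
    \<comment> \<open>Testing against the constant 1 yields the tower property, infinite values
      included.\<close>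
    using nn_cond_exp_intg[of "\<lambda>_. 1" f] assms(2) by simp
qed

lemma ennreal_square_le_sup_norm_on:
  assumes "t \<in> S"
  shows "ennreal ((f t)\<^sup>2) \<le> (sup_norm_on S f)\<^sup>2"
proof -
  have "ennreal \<bar>f t\<bar> \<le> sup_norm_on S f"
    unfolding sup_norm_on_def using assms by (rule SUP_upper)
  then have "(ennreal \<bar>f t\<bar>)\<^sup>2 \<le> (sup_norm_on S f)\<^sup>2"
    by (rule power_mono) simp
  then show ?thesis by (simp add: ennreal_power)
qed

text \<open>The errors of \<open>accurate\<close>, summed before conditioning; the value may be
  infinite, as the sup norms may be.\<close>

definition sup_error where
  "sup_error \<Theta> J DJh Jt z j \<omega> =
     (sup_norm_on \<Theta> (\<lambda>t. DJh j \<omega> t (z j \<omega>) - fst (grad J (t, z j \<omega>))))\<^sup>2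
     + (\<Sum>k\<in>UNIV. (sup_norm_on \<Theta> (\<lambda>t. Jt j \<omega> t (z j \<omega>) $ k - snd (grad J (t, z j \<omega>)) $ k))\<^sup>2)"

lemma borel_measurable_sup_error:
  assumes "accurate M F \<Theta> J DJh Jt \<theta> z \<eta> j"
  shows "sup_error \<Theta> J DJh Jt z j \<in> borel_measurable M"
proof -
  define e where "e = (\<lambda>\<omega>. sup_norm_on \<Theta> (\<lambda>t. DJh j \<omega> t (z j \<omega>) - fst (grad J (t, z j \<omega>))))"
  define e' where
    "e' = (\<lambda>k \<omega>. sup_norm_on \<Theta> (\<lambda>t. Jt j \<omega> t (z j \<omega>) $ k - snd (grad J (t, z j \<omega>)) $ k))"
  have [measurable]: "e \<in> borel_measurable M" "\<And>k. e' k \<in> borel_measurable M"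
    using assms unfolding accurate_def Let_def e_def e'_def by auto
  have "sup_error \<Theta> J DJh Jt z j = (\<lambda>\<omega>. (e \<omega>)\<^sup>2 + (\<Sum>k\<in>UNIV. (e' k \<omega>)\<^sup>2))"
    by (simp add: sup_error_def[abs_def] e_def e'_def)
  then show ?thesis by simp
qed

section \<open>Errors and contraction along the algorithm\<close>

context alternating_descent
begin

lemma measurable_z_M: "z j \<in> borel_measurable M"
  using measurable_from_subalg[OF subalgebra_F measurable_z] .

lemma measurable_theta_M: "\<theta> j \<in> borel_measurable M"
  using measurable_from_subalg[OF subalgebra_F measurable_theta] .

text \<open>Integrating the accuracy condition removes the conditioning on \<open>F j\<close>, so
  only total expectations remain.\<close>

lemma nn_integral_sup_error_le:
  assumes "accurate M F \<Theta> J DJh Jt \<theta> z \<eta> j"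
  shows "(\<integral>\<^sup>+ \<omega>. sup_error \<Theta> J DJh Jt z j \<omega> \<partial>M)
    \<le> (\<integral>\<^sup>+ \<omega>. ennreal (\<eta>\<^sup>2 * (norm (grad J (\<theta> (j - 1) \<omega>, z j \<omega>)))\<^sup>2) \<partial>M)"
proof -
  define e where "e = (\<lambda>\<omega>. sup_norm_on \<Theta> (\<lambda>t. DJh j \<omega> t (z j \<omega>) - fst (grad J (t, z j \<omega>))))"
  define e' where
    "e' = (\<lambda>k \<omega>. sup_norm_on \<Theta> (\<lambda>t. Jt j \<omega> t (z j \<omega>) $ k - snd (grad J (t, z j \<omega>)) $ k))"
  have [measurable]: "e \<in> borel_measurable M" "\<And>k. e' k \<in> borel_measurable M"
    and le: "AE \<omega> in M. nn_cond_exp M (F j) (\<lambda>\<omega>. (e \<omega>)\<^sup>2) \<omega>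
              + (\<Sum>k\<in>UNIV. nn_cond_exp M (F j) (\<lambda>\<omega>. (e' k \<omega>)\<^sup>2) \<omega>)
            \<le> ennreal (\<eta>\<^sup>2 * (norm (grad J (\<theta> (j - 1) \<omega>, z j \<omega>)))\<^sup>2)"
    using assms unfolding accurate_def Let_def e_def e'_def by auto
  have "sup_error \<Theta> J DJh Jt z j = (\<lambda>\<omega>. (e \<omega>)\<^sup>2 + (\<Sum>k\<in>UNIV. (e' k \<omega>)\<^sup>2))"
    by (simp add: sup_error_def[abs_def] e_def e'_def)
  then have "(\<integral>\<^sup>+ \<omega>. sup_error \<Theta> J DJh Jt z j \<omega> \<partial>M)
      = (\<integral>\<^sup>+ \<omega>. (e \<omega>)\<^sup>2 \<partial>M) + (\<Sum>k\<in>UNIV. \<integral>\<^sup>+ \<omega>. (e' k \<omega>)\<^sup>2 \<partial>M)"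
    by (simp add: nn_integral_sum nn_integral_add)
  also have "\<dots> = (\<integral>\<^sup>+ \<omega>. nn_cond_exp M (F j) (\<lambda>\<omega>. (e \<omega>)\<^sup>2) \<omega> \<partial>M)
      + (\<Sum>k\<in>UNIV. \<integral>\<^sup>+ \<omega>. nn_cond_exp M (F j) (\<lambda>\<omega>. (e' k \<omega>)\<^sup>2) \<omega> \<partial>M)"
    by (simp add: nn_integral_nn_cond_exp[OF subalgebra_F])
  also have "\<dots> = (\<integral>\<^sup>+ \<omega>. nn_cond_exp M (F j) (\<lambda>\<omega>. (e \<omega>)\<^sup>2) \<omega>
      + (\<Sum>k\<in>UNIV. nn_cond_exp M (F j) (\<lambda>\<omega>. (e' k \<omega>)\<^sup>2) \<omega>) \<partial>M)"
    by (simp add: nn_integral_sum nn_integral_add)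
  also have "\<dots> \<le> (\<integral>\<^sup>+ \<omega>. ennreal (\<eta>\<^sup>2 * (norm (grad J (\<theta> (j - 1) \<omega>, z j \<omega>)))\<^sup>2) \<partial>M)"
    by (rule nn_integral_mono_AE[OF le])
  finally show ?thesis .
qed

text \<open>Fermat's rule: at an interior point the derivative within \<Theta> is two-sided, so it
  vanishes at a minimiser.\<close>

lemma AE_DJh_eq_0: "AE \<omega> in M. DJh j \<omega> (\<theta> j \<omega>) (z j \<omega>) = 0"
  using derivative_Jh[of j] theta_arg_min[of j] theta_interior[of j]
proof eventually_elim
  case (elim \<omega>)
  let ?f = "\<lambda>s. Jh j \<omega> s (z j \<omega>)"
  have "\<theta> j \<omega> \<in> \<Theta>" using elim(3) interior_subset by blast
  then have "(?f has_real_derivative DJh j \<omega> (\<theta> j \<omega>) (z j \<omega>)) (at (\<theta> j \<omega>))"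
    using elim(1,3) at_within_interior by metis
  moreover obtain r where "r > 0" "ball (\<theta> j \<omega>) r \<subseteq> \<Theta>"
    using elim(3) mem_interior by blast
  moreover have "?f (\<theta> j \<omega>) \<le> ?f y" if "y \<in> \<Theta>" for y
    using elim(2) that unfolding is_arg_min_def by (meson not_le)
  ultimately show ?case
    by (intro DERIV_local_min[of ?f]) (auto simp: dist_real_def subset_eq)
qed

text \<open>As the derivative of the approximation vanishes at \<open>\<theta> j\<close>, the
  \<theta>-derivative of \<open>J\<close> there is, up to sign, the error itself. The point
  \<open>\<theta> j\<close> is random and depends on the approximation, so the errors are taken
  uniformly over \<Theta>.\<close>

lemma AE_errors_le_sup_error:
  "AE \<omega> in M. ennreal ((fst (grad J (\<theta> j \<omega>, z j \<omega>)))\<^sup>2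
      + (norm (Jt j \<omega> (\<theta> j \<omega>) (z j \<omega>) - snd (grad J (\<theta> j \<omega>, z j \<omega>))))\<^sup>2)
    \<le> sup_error \<Theta> J DJh Jt z j \<omega>"
  using AE_DJh_eq_0[of j] theta_interior[of j]
proof eventually_elim
  case (elim \<omega>)
  have t: "\<theta> j \<omega> \<in> \<Theta>" using elim(2) interior_subset by blast
  define g where "g = grad J (\<theta> j \<omega>, z j \<omega>)"
  have n: "(norm x)\<^sup>2 = (\<Sum>k\<in>UNIV. (x $ k)\<^sup>2)" for x :: "real ^ 'n"
    by (simp add: norm_vec_def L2_set_def sum_nonneg)
  have "ennreal ((fst g)\<^sup>2 + (norm (Jt j \<omega> (\<theta> j \<omega>) (z j \<omega>) - snd g))\<^sup>2)
      = ennreal ((fst g)\<^sup>2) + (\<Sum>k\<in>UNIV. ennreal ((Jt j \<omega> (\<theta> j \<omega>) (z j \<omega>) $ k - snd g $ k)\<^sup>2))"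
    by (simp add: n sum_nonneg)
  also have "\<dots> \<le> sup_error \<Theta> J DJh Jt z j \<omega>"
    unfolding sup_error_def
  proof (intro add_mono sum_mono)
    show "ennreal ((fst g)\<^sup>2)
        \<le> (sup_norm_on \<Theta> (\<lambda>t. DJh j \<omega> t (z j \<omega>) - fst (grad J (t, z j \<omega>))))\<^sup>2"
      using ennreal_square_le_sup_norm_on[OF t, of "\<lambda>t. DJh j \<omega> t (z j \<omega>) - fst (grad J (t, z j \<omega>))"]
        elim(1) by (simp add: g_def)
    show "ennreal ((Jt j \<omega> (\<theta> j \<omega>) (z j \<omega>) $ k - snd g $ k)\<^sup>2)
        \<le> (sup_norm_on \<Theta> (\<lambda>t. Jt j \<omega> t (z j \<omega>) $ k - snd (grad J (t, z j \<omega>)) $ k))\<^sup>2" for k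
      using ennreal_square_le_sup_norm_on[OF t,
          of "\<lambda>t. Jt j \<omega> t (z j \<omega>) $ k - snd (grad J (t, z j \<omega>)) $ k"]
      by (simp add: g_def)
  qed
  finally show ?case by (simp add: g_def)
qed

text \<open>The gap between the factors \<open>1 - \<alpha> * \<mu> / 2\<close> and
  \<open>1 - \<alpha> * \<mu> / 4\<close> pays for the approximation errors; the hypothesis on
  \<eta> says that it suffices.\<close>

lemma mean_square_contraction:
  fixes J :: "real \<times> (real ^ 'n) \<Rightarrow> real"
  assumes diff: "\<And>w. J differentiable (at w)" and lip: "L-lipschitz_on UNIV (grad J)"
    and "L > 0" and min: "is_arg_min J (\<lambda>_. True) (\<theta>s, zs)"
    and sc: "strongly_convex \<mu> J" and "\<mu> > 0" and "0 < \<alpha>" and "\<alpha> \<le> 1 / L" and "\<alpha> * \<mu> \<le> 1"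
    and acc: "accurate M F \<Theta> J DJh Jt \<theta> z \<eta> j"
    and \<eta>: "(3 * \<alpha> / \<mu> + (1 + 2 / (\<alpha> * \<mu>)) * \<alpha>\<^sup>2) * (\<eta>\<^sup>2 * L\<^sup>2) \<le> \<alpha> * \<mu> / 4"
  shows "(\<integral>\<^sup>+ \<omega>. ennreal ((norm (z (Suc j) \<omega> - zs))\<^sup>2 + \<alpha> * \<mu> / 2 * (\<theta> j \<omega> - \<theta>s)\<^sup>2) \<partial>M)
    \<le> ennreal (1 - \<alpha> * \<mu> / 4)
      * (\<integral>\<^sup>+ \<omega>. ennreal ((norm (z j \<omega> - zs))\<^sup>2 + \<alpha> * \<mu> / 2 * (\<theta> (j - 1) \<omega> - \<theta>s)\<^sup>2) \<partial>M)"
proof -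
  define q K where "q = \<alpha> * \<mu>" and "K = 3 * \<alpha> / \<mu> + (1 + 2 / (\<alpha> * \<mu>)) * \<alpha>\<^sup>2"
  have q: "0 < q" "q \<le> 1" using assms by (auto simp: q_def)
  have parts: "0 \<le> 3 * \<alpha> / \<mu>" "0 \<le> (1 + 2 / (\<alpha> * \<mu>)) * \<alpha>\<^sup>2" using assms by auto
  then have "K \<ge> 0" by (simp add: K_def)
  note [measurable] = measurable_z_M measurable_theta_M borel_measurable_sup_error[OF acc]
  let ?E = "sup_error \<Theta> J DJh Jt z j"
  let ?D = "\<lambda>\<omega>. (\<theta> (j - 1) \<omega> - \<theta>s)\<^sup>2 + (norm (z j \<omega> - zs))\<^sup>2"

  have "AE \<omega> in M. ennreal ((norm (z (Suc j) \<omega> - zs))\<^sup>2 + q / 2 * (\<theta> j \<omega> - \<theta>s)\<^sup>2)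
      \<le> ennreal ((1 - q / 2) * (norm (z j \<omega> - zs))\<^sup>2) + ennreal K * ?E \<omega>"
    using z_Suc[of j] AE_errors_le_sup_error[of J j]
  proof eventually_elim
    case (elim \<omega>)
    define a where "a = (fst (grad J (\<theta> j \<omega>, z j \<omega>)))\<^sup>2"
    define b where "b = (norm (Jt j \<omega> (\<theta> j \<omega>) (z j \<omega>) - snd (grad J (\<theta> j \<omega>, z j \<omega>))))\<^sup>2"
    have ab: "0 \<le> a" "0 \<le> b" by (auto simp: a_def b_def)
    \<comment> \<open>As the sum of both error constants, \<open>K\<close> dominates each, so a
      single multiple of \<open>a + b\<close> can be compared with \<open>?E\<close>.\<close>
    have "3 * \<alpha> / \<mu> * a + (1 + 2 / (\<alpha> * \<mu>)) * \<alpha>\<^sup>2 * b \<le> K * a + K * b"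
      unfolding K_def using parts ab by (intro add_mono mult_right_mono) auto
    then have "(norm (z (Suc j) \<omega> - zs))\<^sup>2 + q / 2 * (\<theta> j \<omega> - \<theta>s)\<^sup>2
        \<le> (1 - q / 2) * (norm (z j \<omega> - zs))\<^sup>2 + K * (a + b)"
      using perturbed_partial_gradient_step[OF diff lip \<open>L > 0\<close> min sc \<open>\<mu> > 0\<close> \<open>0 < \<alpha>\<close>
          \<open>\<alpha> \<le> 1 / L\<close> \<open>\<alpha> * \<mu> \<le> 1\<close>, of "z j \<omega>" "Jt j \<omega> (\<theta> j \<omega>) (z j \<omega>)" "\<theta> j \<omega>"]
      unfolding elim(1) a_def[symmetric] b_def[symmetric] q_def[symmetric] by (simp add: distrib_left)
    then have "ennreal ((norm (z (Suc j) \<omega> - zs))\<^sup>2 + q / 2 * (\<theta> j \<omega> - \<theta>s)\<^sup>2)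
        \<le> ennreal ((1 - q / 2) * (norm (z j \<omega> - zs))\<^sup>2 + K * (a + b))"
      by (rule ennreal_leI)
    also have "\<dots> = ennreal ((1 - q / 2) * (norm (z j \<omega> - zs))\<^sup>2) + ennreal K * ennreal (a + b)"
      using q \<open>K \<ge> 0\<close> ab by (subst ennreal_plus) (auto simp: ennreal_mult)
    also have "\<dots> \<le> ennreal ((1 - q / 2) * (norm (z j \<omega> - zs))\<^sup>2) + ennreal K * ?E \<omega>"
      using elim(2) by (intro add_left_mono mult_left_mono) (auto simp: a_def b_def)
    finally show ?case .
  qed
  then have "(\<integral>\<^sup>+ \<omega>. ennreal ((norm (z (Suc j) \<omega> - zs))\<^sup>2 + q / 2 * (\<theta> j \<omega> - \<theta>s)\<^sup>2) \<partial>M)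
      \<le> (\<integral>\<^sup>+ \<omega>. ennreal ((1 - q / 2) * (norm (z j \<omega> - zs))\<^sup>2) + ennreal K * ?E \<omega> \<partial>M)"
    by (rule nn_integral_mono_AE)
  also have "\<dots> = (\<integral>\<^sup>+ \<omega>. ennreal ((1 - q / 2) * (norm (z j \<omega> - zs))\<^sup>2) \<partial>M)
      + ennreal K * (\<integral>\<^sup>+ \<omega>. ?E \<omega> \<partial>M)"
    by (simp add: nn_integral_add nn_integral_cmult)
  also have "(\<integral>\<^sup>+ \<omega>. ?E \<omega> \<partial>M)
      \<le> (\<integral>\<^sup>+ \<omega>. ennreal (\<eta>\<^sup>2 * (norm (grad J (\<theta> (j - 1) \<omega>, z j \<omega>)))\<^sup>2) \<partial>M)"
    by (rule nn_integral_sup_error_le[OF acc])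
  also have "\<dots> \<le> (\<integral>\<^sup>+ \<omega>. ennreal (\<eta>\<^sup>2 * L\<^sup>2 * ?D \<omega>) \<partial>M)"
  proof (intro nn_integral_mono ennreal_leI)
    fix \<omega>
    \<comment> \<open>The gradient vanishes at the minimiser, so the Lipschitz bound measures the
      distance to it.\<close>
    have "norm (grad J (\<theta> (j - 1) \<omega>, z j \<omega>)) \<le> L * norm ((\<theta> (j - 1) \<omega>, z j \<omega>) - (\<theta>s, zs))"
      using lipschitz_onD[OF lip, of "(\<theta> (j - 1) \<omega>, z j \<omega>)" "(\<theta>s, zs)"]
        grad_arg_min_eq_0[OF diff lip \<open>L > 0\<close> min] by (simp add: dist_norm)
    then have "(norm (grad J (\<theta> (j - 1) \<omega>, z j \<omega>)))\<^sup>2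
        \<le> (L * norm ((\<theta> (j - 1) \<omega>, z j \<omega>) - (\<theta>s, zs)))\<^sup>2"
      by (rule power_mono) simp
    also have "\<dots> = L\<^sup>2 * ?D \<omega>"
      by (simp add: power_mult_distrib norm_Pair)
    finally show "\<eta>\<^sup>2 * (norm (grad J (\<theta> (j - 1) \<omega>, z j \<omega>)))\<^sup>2 \<le> \<eta>\<^sup>2 * L\<^sup>2 * ?D \<omega>"
      by (simp add: mult.assoc mult_left_mono)
  qed
  also have "(\<integral>\<^sup>+ \<omega>. ennreal ((1 - q / 2) * (norm (z j \<omega> - zs))\<^sup>2) \<partial>M)
        + ennreal K * (\<integral>\<^sup>+ \<omega>. ennreal (\<eta>\<^sup>2 * L\<^sup>2 * ?D \<omega>) \<partial>M)
      = (\<integral>\<^sup>+ \<omega>. ennreal ((1 - q / 2) * (norm (z j \<omega> - zs))\<^sup>2)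
          + ennreal K * ennreal (\<eta>\<^sup>2 * L\<^sup>2 * ?D \<omega>) \<partial>M)"
    by (simp add: nn_integral_add nn_integral_cmult)
  also have "\<dots> \<le> (\<integral>\<^sup>+ \<omega>. ennreal (1 - q / 4)
      * ennreal ((norm (z j \<omega> - zs))\<^sup>2 + q / 2 * (\<theta> (j - 1) \<omega> - \<theta>s)\<^sup>2) \<partial>M)"
  proof (intro nn_integral_mono)
    fix \<omega>
    have "K * (\<eta>\<^sup>2 * L\<^sup>2) * ?D \<omega> \<le> q / 4 * ?D \<omega>"
      using \<eta> unfolding K_def q_def by (intro mult_right_mono) auto
    \<comment> \<open>The old \<theta>-deviation enters only through the errors, with coefficient at
      most \<open>q / 4\<close>; this must fit below the contraction factor times the weight
      \<open>q / 2\<close>.\<close>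
    moreover have "q / 4 * (\<theta> (j - 1) \<omega> - \<theta>s)\<^sup>2 \<le> (1 - q / 4) * (q / 2) * (\<theta> (j - 1) \<omega> - \<theta>s)\<^sup>2"
    proof (intro mult_right_mono)
      have "q * q \<le> q * 1" using q by (intro mult_left_mono) auto
      moreover have "(1 - q / 4) * (q / 2) = q / 2 - q * q / 8" by (simp add: field_simps)
      ultimately show "q / 4 \<le> (1 - q / 4) * (q / 2)" using q by linarith
    qed simp
    ultimately have "(1 - q / 2) * (norm (z j \<omega> - zs))\<^sup>2 + K * (\<eta>\<^sup>2 * L\<^sup>2 * ?D \<omega>)
        \<le> (1 - q / 4) * ((norm (z j \<omega> - zs))\<^sup>2 + q / 2 * (\<theta> (j - 1) \<omega> - \<theta>s)\<^sup>2)"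
      by (simp only: distrib_left mult.assoc left_diff_distrib)
    then have "ennreal ((1 - q / 2) * (norm (z j \<omega> - zs))\<^sup>2 + K * (\<eta>\<^sup>2 * L\<^sup>2 * ?D \<omega>))
        \<le> ennreal ((1 - q / 4) * ((norm (z j \<omega> - zs))\<^sup>2 + q / 2 * (\<theta> (j - 1) \<omega> - \<theta>s)\<^sup>2))"
      by (rule ennreal_leI)
    moreover have "ennreal ((1 - q / 2) * (norm (z j \<omega> - zs))\<^sup>2 + K * (\<eta>\<^sup>2 * L\<^sup>2 * ?D \<omega>))
        = ennreal ((1 - q / 2) * (norm (z j \<omega> - zs))\<^sup>2) + ennreal K * ennreal (\<eta>\<^sup>2 * L\<^sup>2 * ?D \<omega>)"
      using q \<open>K \<ge> 0\<close> by (subst ennreal_plus) (auto simp: ennreal_mult)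
    ultimately show "ennreal ((1 - q / 2) * (norm (z j \<omega> - zs))\<^sup>2) + ennreal K * ennreal (\<eta>\<^sup>2 * L\<^sup>2 * ?D \<omega>)
        \<le> ennreal (1 - q / 4) * ennreal ((norm (z j \<omega> - zs))\<^sup>2 + q / 2 * (\<theta> (j - 1) \<omega> - \<theta>s)\<^sup>2)"
      using q by (simp add: ennreal_mult)
  qed
  also have "\<dots> = ennreal (1 - q / 4)
      * (\<integral>\<^sup>+ \<omega>. ennreal ((norm (z j \<omega> - zs))\<^sup>2 + q / 2 * (\<theta> (j - 1) \<omega> - \<theta>s)\<^sup>2) \<partial>M)"
    by (simp add: nn_integral_cmult)
  \<comment> \<open>The bounds on the integral of \<open>?E\<close> were inserted inside a larger
    sum; the monotonicity of that sum in the integral is discharged here.\<close>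
  finally show ?thesis
    unfolding q_def by (simp add: add_left_mono mult_left_mono)
qed

end

text \<open>The accuracy must be good enough, hence the threshold \<open>\<eta>\<^sub>0\<close>.
  Both constants are fixed before the probability space and the process, so they are uniform in
  these and in \<open>j\<close>; the witnesses depend only on \<alpha> and \<mu>.\<close>

theorem theorem3p1:
  fixes J :: "real \<times> (real ^ 'n) \<Rightarrow> real"
    and \<Theta> :: "real set" and \<mu> L \<alpha> \<theta>s :: real and zs :: "real ^ 'n"
  assumes "convex \<Theta>"
    and "\<And>w. J differentiable (at w)"
    and "\<mu> > 0" and "strongly_convex \<mu> J"
    and "L > 0" and "L-lipschitz_on UNIV (grad J)"
    and "is_arg_min J (\<lambda>_. True) (\<theta>s, zs)"
    and "0 < \<alpha>" and "\<alpha> \<le> 1 / L" and "\<alpha> * \<mu> \<le> 1"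
  shows "\<exists>\<eta>\<^sub>0 > 0. \<forall>\<eta>. 0 < \<eta> \<and> \<eta> \<le> \<eta>\<^sub>0 \<longrightarrow>
    (\<exists>C\<^sub>1 > 0. \<exists>\<xi>. 0 < \<xi> \<and> \<xi> < 1 \<and>
      (\<forall>(M :: 'p measure) F z0 Jh DJh Jt \<theta> z.
        alternating_descent M F \<Theta> \<alpha> z0 Jh DJh Jt \<theta> z \<longrightarrow>
        (\<forall>j \<ge> 1. accurate M F \<Theta> J DJh Jt \<theta> z \<eta> j \<longrightarrow>
          (\<integral>\<^sup>+ \<omega>. ennreal ((norm (z (Suc j) \<omega> - zs))\<^sup>2 + C\<^sub>1 * (\<theta> j \<omega> - \<theta>s)\<^sup>2) \<partial>M)
          \<le> ennreal \<xi> *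
            (\<integral>\<^sup>+ \<omega>. ennreal ((norm (z j \<omega> - zs))\<^sup>2 + C\<^sub>1 * (\<theta> (j - 1) \<omega> - \<theta>s)\<^sup>2) \<partial>M))))"
proof -
  define K where "K = 3 * \<alpha> / \<mu> + (1 + 2 / (\<alpha> * \<mu>)) * \<alpha>\<^sup>2"
  \<comment> \<open>Chosen so that \<open>K * (\<eta>0\<^sup>2 * L\<^sup>2)\<close> equals
    \<open>\<alpha> * \<mu> / 4\<close>, the largest error the contraction tolerates.\<close>
  define \<eta>0 where "\<eta>0 = sqrt (\<alpha> * \<mu> / (4 * K * L\<^sup>2))"
  have q: "0 < \<alpha> * \<mu>" using assms by simp
  then have "0 < \<alpha> * \<mu> / 2" by simp
  have \<xi>: "0 < 1 - \<alpha> * \<mu> / 4" "1 - \<alpha> * \<mu> / 4 < 1" using q assms by auto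
  have "K > 0" unfolding K_def using assms by (intro add_pos_nonneg) auto
  have pos: "\<eta>0 > 0" unfolding \<eta>0_def using q \<open>K > 0\<close> \<open>L > 0\<close> by simp
  have small: "K * (\<eta>\<^sup>2 * L\<^sup>2) \<le> \<alpha> * \<mu> / 4" if "0 < \<eta> \<and> \<eta> \<le> \<eta>0" for \<eta>
  proof -
    have "\<eta>\<^sup>2 \<le> \<eta>0\<^sup>2" using that by (intro power_mono) auto
    also have "\<dots> = \<alpha> * \<mu> / (4 * K * L\<^sup>2)"
      unfolding \<eta>0_def using q \<open>K > 0\<close> by (intro real_sqrt_pow2) simp
    finally show ?thesis using \<open>K > 0\<close> \<open>L > 0\<close> by (simp add: field_simps)
  qed
  show ?thesis
    by (rule exI[of _ \<eta>0], rule conjI[OF pos], intro allI impI,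
        rule exI[of _ "\<alpha> * \<mu> / 2"], rule conjI[OF \<open>0 < \<alpha> * \<mu> / 2\<close>],
        rule exI[of _ "1 - \<alpha> * \<mu> / 4"], intro conjI allI impI \<xi>)
       (rule alternating_descent.mean_square_contraction
          [OF _ assms(2,6,5,7,4,3,8,9,10) _ small[unfolded K_def]]; assumption)
qed

end
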